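(* Let $(Y,\mathfrak s)$ be a spin rational homology three-sphere, and let $\omega(Y,\mathfrak s)=\min\{n\mid U^n\,HF_{\mathrm{conn}}(Y,\mathfrak s)=0\}$. Then (1) $\tfrac12\big(d(Y,\mathfrak s)-\underline d(Y,\mathfrak s)\big)\le\omega(Y,\mathfrak s)$; (2) $\tfrac12\big(\bar d(Y,\mathfrak s)-d(Y,\mathfrak s)\big)\le\omega(Y,\mathfrak s)$.
   Context: $\mathbb F=\mathbb Z/2\mathbb Z$, and $U$ has degree $-2$. For a rational homology three-sphere $Y$ with spin structure $\mathfrak s$, $CF^-(Y,\mathfrak s)$ is the minus Heegaard Floer complex, a finitely generated free chain complex over $\mathbb F[U]$ with absolute $\mathbb Q$-grading, normalized so that $HF^-(S^3)=\mathbb F[U]$ with $\mathrm{gr}(1)=-2$. The conjugation involution $\iota: CF^-(Y,\mathfrak s)\to CF^-(Y,\mathfrak s)$ is defined as follows: for a pointed Heegaard diagram $(\Sigma,\boldsymbol\alpha,\boldsymbol\beta,z)$ of $Y$ (with a family of almost complex structures), $\iota=\Phi\circ\eta$, where $\eta$ is the canonical chain isomorphism to the complex of the conjugate diagram $(-\Sigma,\boldsymbol\beta,\boldsymbol\alpha,z)$ (with conjugate almost complex structures) and $\Phi$ is the chain homotopy equivalence induced by a sequence of Heegaard moves and changes of almost complex structure from the conjugate diagram back to the original one. It is a grading-preserving chain map with $\iota^2\simeq\mathrm{id}$ ($\simeq$ means chain homotopic over $\mathbb F[U]$). Connected homology. For $C=CF^-(Y,\mathfrak s)$, a self-local equivalence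 is a grading-preserving chain map $f:C\to C$ over $\mathbb F[U]$ with $f\circ\iota\simeq\iota\circ f$ inducing an isomorphism on $U^{-1}H_*(C)$. Preorder: $f\lesssim g$ if $\ker f\subseteq\ker g$. $f$ is maximal if for every self-local equivalence $g$, $g\gtrsim f$ implies $g\lesssim f$. $HF_{\mathrm{conn}}(Y,\mathfrak s)$ is the $U$-torsion submodule of $H_*(\operatorname{im} f)$, with gradings raised by $1$, for any maximal self-local equivalence $f$ (well defined up to graded isomorphism). Involutive homology. $CFI^-(Y,\mathfrak s)$ is the mapping cone of $Q(1+\iota):CF^-(Y,\mathfrak s)\to Q\cdot CF^-(Y,\mathfrak s)[-1]$, where $Q$ is a formal variable of degree $-1$ with $Q^2=0$ and $[-1]$ raises gradings by $1$; if $x\in CF^-$ has grading $r$, then in $CFI^-$ one has $\mathrm{gr}(x)=r+1$ and $\mathrm{gr}(Qx)=r$. $HFI^-(Y,\mathfrak s)$ is its homology. Correction terms: $d(Y,\mathfrak s)=\max\{r\mid\exists x\in HF^-_r(Y,\mathfrak s),\ \forall n,\ U^nx\ne0\}+2$; $\underline d(Y,\mathfrak s)=\max\{r\mid\exists x\in HFI^-_r(Y,\mathfrak s),\ \forall n,\ U^nx\neq0\text{ and }U^nx\notin\operatorname{Im}(Q)\}+1$; $\bar d(Y,\mathfrak s)=\max\{r\mid\exists x\in HFI^-_r(Y,\mathfrak s),\ \forall n,\ U^nx\neq0;\ \exists m\ge0\text{ s.t. }U^mx\in\operatorname{Im}(Q)\}+2$. *)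

theory Defs
  imports
    "HOL-Analysis.Finite_Cartesian_Product"
    "HOL-Computational_Algebra.Polynomial"
    "HOL-Library.Z2"
    "HOL-Library.Poly_Mapping"
begin

text \<open>
  The ground ring \<open>\<bbbF>[U]\<close>, \<open>\<bbbF> = \<int>/2\<close>, is \<^typ>\<open>bit poly\<close>, and \<open>U\<close> has degree \<open>-2\<close>.
  The pair \<open>(CF\<^sup>-(Y,\<s>), \<iota>)\<close> enters through the structure it carries: a finitely
  generated free \<open>\<rat>\<close>-graded chain complex over \<open>\<bbbF>[U]\<close> with
  \<open>U\<^sup>-\<^sup>1 H\<^sub>* \<cong> \<bbbF>[U,U\<^sup>-\<^sup>1]\<close>, and a grading-preserving chain map \<open>\<iota>\<close> with \<open>\<iota>\<^sup>2 \<simeq> id\<close>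
  (an iota-complex). Heegaard diagrams and holomorphic curves are not formalized.
\<close>

definition U :: "bit poly" where
  "U = monom 1 1"


section \<open>Graded complexes and their homology\<close>

text \<open>
  The field \<open>homog K r\<close> is the set of homogeneous elements of degree \<open>r\<close>, including \<open>0\<close>.
  The underlying set may be a proper subset of the type, so that subcomplexes are complexes.
\<close>

record 'a gr_complex =
  elts :: "'a set"
  scal :: "bit poly \<Rightarrow> 'a \<Rightarrow> 'a"
  homog :: "rat \<Rightarrow> 'a set"
  bdry :: "'a \<Rightarrow> 'a"

definition cycles :: "'a::ab_group_add gr_complex \<Rightarrow> 'a set" where
  "cycles K = {z \<in> elts K. bdry K z = 0}"

definition boundaries :: "'a::ab_group_add gr_complex \<Rightarrow> 'a set" where
  "boundaries K = bdry K ` elts K"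

text \<open>Homology classes are cosets of \<^term>\<open>boundaries K\<close>; this coset itself is the class \<open>0\<close>.\<close>

definition hclass :: "'a::ab_group_add gr_complex \<Rightarrow> 'a \<Rightarrow> 'a set" where
  "hclass K z = {z + b | b. b \<in> boundaries K}"

definition homology :: "'a::ab_group_add gr_complex \<Rightarrow> 'a set set" where
  "homology K = hclass K ` cycles K"

definition homology_deg :: "'a::ab_group_add gr_complex \<Rightarrow> rat \<Rightarrow> 'a set set" where
  "homology_deg K r = hclass K ` (cycles K \<inter> homog K r)"

definition hadd :: "'a::ab_group_add set \<Rightarrow> 'a set \<Rightarrow> 'a set" where
  "hadd X Y = {x + y | x y. x \<in> X \<and> y \<in> Y}"

definition induced :: "'a::ab_group_add gr_complex \<Rightarrow> ('a \<Rightarrow> 'a) \<Rightarrow> 'a set \<Rightarrow> 'a set" where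
  "induced K g X = {g z + b | z b. z \<in> X \<and> b \<in> boundaries K}"

definition hscal :: "'a::ab_group_add gr_complex \<Rightarrow> bit poly \<Rightarrow> 'a set \<Rightarrow> 'a set" where
  "hscal K p = induced K (scal K p)"


section \<open>The localization \<open>U\<^sup>-\<^sup>1 H\<^sub>*\<close>\<close>

text \<open>The pair \<open>(X, m)\<close> represents the fraction \<open>U\<^sup>-\<^sup>m X\<close>.\<close>

definition frac_rel :: "'a::ab_group_add gr_complex \<Rightarrow> (('a set \<times> nat) \<times> ('a set \<times> nat)) set" where
  "frac_rel K = {((X, m), (Y, n)) | X m Y n. X \<in> homology K \<and> Y \<in> homology K \<and>
     (\<exists>k. hscal K (U ^ (k + n)) X = hscal K (U ^ (k + m)) Y)}"

definition frac :: "'a::ab_group_add gr_complex \<Rightarrow> 'a set \<Rightarrow> nat \<Rightarrow> ('a set \<times> nat) set" where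
  "frac K X m = frac_rel K `` {(X, m)}"

definition loc :: "'a::ab_group_add gr_complex \<Rightarrow> ('a set \<times> nat) set set" where
  "loc K = (homology K \<times> UNIV) // frac_rel K"

definition loc_map ::
  "'a::ab_group_add gr_complex \<Rightarrow> ('a \<Rightarrow> 'a) \<Rightarrow> ('a set \<times> nat) set \<Rightarrow> ('a set \<times> nat) set" where
  "loc_map K g c = (\<Union>(X, m)\<in>c. frac K (induced K g X) m)"

text \<open>
  \<open>U\<^sup>-\<^sup>1 H\<^sub>*(K) \<cong> \<bbbF>[U,U\<^sup>-\<^sup>1]\<close> as relatively graded modules. Laurent polynomials are
  finitely supported functions \<open>\<int> \<rightarrow> \<bbbF>\<close> with convolution as product; \<open>\<tau>\<close> is the degree
  of the class corresponding to \<open>1\<close>. An additive map commuting with \<open>U\<close> is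
  \<open>\<bbbF>[U,U\<^sup>-\<^sup>1]\<close>-linear, since \<open>\<bbbF>\<close> has two elements.
\<close>

definition loc_is_laurent :: "'a::ab_group_add gr_complex \<Rightarrow> bool" where
  "loc_is_laurent K \<longleftrightarrow>
     (\<exists>(\<phi> :: ('a set \<times> nat) set \<Rightarrow> (int \<Rightarrow>\<^sub>0 bit)) (\<tau> :: rat).
        bij_betw \<phi> (loc K) UNIV \<and>
        (\<forall>X\<in>homology K. \<forall>Y\<in>homology K. \<forall>m n.
           \<phi> (frac K (hadd (hscal K (U ^ n) X) (hscal K (U ^ m) Y)) (m + n)) =
           \<phi> (frac K X m) + \<phi> (frac K Y n)) \<and>
        (\<forall>X\<in>homology K. \<forall>m.
           \<phi> (frac K (hscal K U X) m) = Poly_Mapping.single 1 1 * \<phi> (frac K X m)) \<and>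
        (\<forall>r. \<forall>X\<in>homology_deg K r. \<forall>m. \<forall>k\<in>Poly_Mapping.keys (\<phi> (frac K X m)).
           \<tau> - 2 * of_int k = r + 2 * of_nat m))"


section \<open>Iota-complexes\<close>

text \<open>
  A finitely generated free graded complex is given by a finite homogeneous basis indexed
  by \<open>'n\<close>, with gradings \<open>gr\<close>, and a differential \<open>d\<close>.
\<close>

definition free_complex ::
  "('n::finite \<Rightarrow> rat) \<Rightarrow> (bit poly ^ 'n \<Rightarrow> bit poly ^ 'n) \<Rightarrow> (bit poly ^ 'n) gr_complex" where
  "free_complex gr d =
     \<lparr> elts = UNIV,
       scal = (\<lambda>p x. p *s x),
       homog = (\<lambda>r. {x. \<forall>i k. coeff (x $ i) k \<noteq> 0 \<longrightarrow> gr i - 2 * of_nat k = r}),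
       bdry = d \<rparr>"

text \<open>The next three notions are used only for complexes whose underlying set is the whole type.\<close>

definition chain_map :: "'a::ab_group_add gr_complex \<Rightarrow> ('a \<Rightarrow> 'a) \<Rightarrow> bool" where
  "chain_map K f \<longleftrightarrow>
     module_hom (scal K) (scal K) f \<and>
     (\<forall>x. f (bdry K x) = bdry K (f x)) \<and>
     (\<forall>r. f ` homog K r \<subseteq> homog K r)"

definition homotopic :: "'a::ab_group_add gr_complex \<Rightarrow> ('a \<Rightarrow> 'a) \<Rightarrow> ('a \<Rightarrow> 'a) \<Rightarrow> bool" where
  "homotopic K f g \<longleftrightarrow>
     (\<exists>h. module_hom (scal K) (scal K) h \<and>
          (\<forall>r. h ` homog K r \<subseteq> homog K (r + 1)) \<and>
          (\<forall>x. f x - g x = bdry K (h x) + h (bdry K x)))"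

definition chain_complex :: "'a::ab_group_add gr_complex \<Rightarrow> bool" where
  "chain_complex K \<longleftrightarrow>
     module_hom (scal K) (scal K) (bdry K) \<and>
     (\<forall>x. bdry K (bdry K x) = 0) \<and>
     (\<forall>r. bdry K ` homog K r \<subseteq> homog K (r - 1))"

definition iota_complex ::
  "('n::finite \<Rightarrow> rat) \<Rightarrow> (bit poly ^ 'n \<Rightarrow> bit poly ^ 'n) \<Rightarrow> (bit poly ^ 'n \<Rightarrow> bit poly ^ 'n) \<Rightarrow> bool"
  where
  "iota_complex gr d \<iota> \<longleftrightarrow>
     chain_complex (free_complex gr d) \<and>
     loc_is_laurent (free_complex gr d) \<and>
     chain_map (free_complex gr d) \<iota> \<and>
     homotopic (free_complex gr d) (\<iota> \<circ> \<iota>) id"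


section \<open>Connected homology\<close>

definition self_local_equiv ::
  "'a::ab_group_add gr_complex \<Rightarrow> ('a \<Rightarrow> 'a) \<Rightarrow> ('a \<Rightarrow> 'a) \<Rightarrow> bool" where
  "self_local_equiv C \<iota> f \<longleftrightarrow>
     chain_map C f \<and>
     homotopic C (f \<circ> \<iota>) (\<iota> \<circ> f) \<and>
     bij_betw (loc_map C f) (loc C) (loc C)"

definition ker_le :: "('a::ab_group_add \<Rightarrow> 'a) \<Rightarrow> ('a \<Rightarrow> 'a) \<Rightarrow> bool" (infix \<open>\<lesssim>\<close> 50) where
  "f \<lesssim> g \<longleftrightarrow> {x. f x = 0} \<subseteq> {x. g x = 0}"

definition maximal_self_local_equiv ::
  "'a::ab_group_add gr_complex \<Rightarrow> ('a \<Rightarrow> 'a) \<Rightarrow> ('a \<Rightarrow> 'a) \<Rightarrow> bool" where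
  "maximal_self_local_equiv C \<iota> f \<longleftrightarrow>
     self_local_equiv C \<iota> f \<and>
     (\<forall>g. self_local_equiv C \<iota> g \<longrightarrow> f \<lesssim> g \<longrightarrow> g \<lesssim> f)"

definition image_complex :: "'a::ab_group_add gr_complex \<Rightarrow> ('a \<Rightarrow> 'a) \<Rightarrow> 'a gr_complex" where
  "image_complex C f = C \<lparr> elts := range f, homog := (\<lambda>r. homog C r \<inter> range f) \<rparr>"

text \<open>
  The degree \<open>r\<close> part of the graded module \<open>HF\<^sub>c\<^sub>o\<^sub>n\<^sub>n\<close>, computed from a maximal self-local
  equivalence \<open>f\<close>; because gradings are raised by \<open>1\<close> it comes from degree \<open>r - 1\<close>.
\<close>

definition HF_conn :: "'a::ab_group_add gr_complex \<Rightarrow> ('a \<Rightarrow> 'a) \<Rightarrow> rat \<Rightarrow> 'a set set" where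
  "HF_conn C f r =
     {X \<in> homology_deg (image_complex C f) (r - 1).
        \<exists>n. hscal (image_complex C f) (U ^ n) X = boundaries (image_complex C f)}"

definition \<omega> :: "'a::ab_group_add gr_complex \<Rightarrow> ('a \<Rightarrow> 'a) \<Rightarrow> nat" where
  "\<omega> C f = (LEAST n. \<forall>r. \<forall>X\<in>HF_conn C f r.
     hscal (image_complex C f) (U ^ n) X = boundaries (image_complex C f))"


section \<open>Involutive homology and correction terms\<close>

text \<open>The pair \<open>(x, y)\<close> stands for \<open>x + Q y\<close> in the mapping cone of \<open>Q(1 + \<iota>)\<close>.\<close>

definition CFI :: "'a::ab_group_add gr_complex \<Rightarrow> ('a \<Rightarrow> 'a) \<Rightarrow> ('a \<times> 'a) gr_complex" where
  "CFI C \<iota> =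
     \<lparr> elts = elts C \<times> elts C,
       scal = (\<lambda>p (x, y). (scal C p x, scal C p y)),
       homog = (\<lambda>r. homog C (r - 1) \<times> homog C r),
       bdry = (\<lambda>(x, y). (bdry C x, (x + \<iota> x) + bdry C y)) \<rparr>"

definition Q :: "'a::ab_group_add \<times> 'a \<Rightarrow> 'a \<times> 'a" where
  "Q = (\<lambda>(x, y). (0, x))"

definition im_Q :: "'a::ab_group_add gr_complex \<Rightarrow> ('a \<Rightarrow> 'a) \<Rightarrow> ('a \<times> 'a) set set" where
  "im_Q C \<iota> = induced (CFI C \<iota>) Q ` homology (CFI C \<iota>)"

definition d_inv :: "'a::ab_group_add gr_complex \<Rightarrow> rat" where
  "d_inv C =
     (GREATEST r. \<exists>X\<in>homology_deg C r. \<forall>n. hscal C (U ^ n) X \<noteq> boundaries C) + 2"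

definition d_lower :: "'a::ab_group_add gr_complex \<Rightarrow> ('a \<Rightarrow> 'a) \<Rightarrow> rat" where
  "d_lower C \<iota> =
     (GREATEST r. \<exists>X\<in>homology_deg (CFI C \<iota>) r. \<forall>n.
        hscal (CFI C \<iota>) (U ^ n) X \<noteq> boundaries (CFI C \<iota>) \<and>
        hscal (CFI C \<iota>) (U ^ n) X \<notin> im_Q C \<iota>) + 1"

definition d_upper :: "'a::ab_group_add gr_complex \<Rightarrow> ('a \<Rightarrow> 'a) \<Rightarrow> rat" where
  "d_upper C \<iota> =
     (GREATEST r. \<exists>X\<in>homology_deg (CFI C \<iota>) r.
        (\<forall>n. hscal (CFI C \<iota>) (U ^ n) X \<noteq> boundaries (CFI C \<iota>)) \<and>
        (\<exists>m. hscal (CFI C \<iota>) (U ^ m) X \<in> im_Q C \<iota>)) + 2"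

end

theory Submission
  imports Defs
begin

text \<open>
  Let \<open>f\<close> be a self-local equivalence and \<open>n\<close> the exponent of the torsion of
  \<open>H\<^sub>*(im f)\<close>. If a cycle \<open>z\<close> is torsion in \<open>H\<^sub>*(C)\<close>, then \<open>f z\<close> is torsion already in
  \<open>H\<^sub>*(im f)\<close>, so \<open>U\<^sup>n f z\<close> bounds. Moreover \<open>x + \<iota> x\<close> is torsion for every homogeneous cycle
  \<open>x\<close>, as \<open>\<iota>\<close> is an involution up to homotopy and the localization is at most
  one-dimensional in each degree.

  (1) If \<open>x\<close> is nontorsion of top degree, then \<open>U\<^sup>n f (x + \<iota> x)\<close> bounds, hence so does
  \<open>(1 + \<iota>) U\<^sup>n f x\<close>, and \<open>U\<^sup>n f x\<close> lifts to a cycle of the mapping cone.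

  (2) If \<open>x + Q y\<close> realizes the upper correction term, then \<open>x\<close> is torsion, so
  \<open>U\<^sup>n f x = \<partial> f c\<close>. With \<open>h\<close> a homotopy from \<open>f \<iota>\<close> to \<open>\<iota> f\<close>, subtracting the boundary of
  \<open>f c\<close> from the image of \<open>U\<^sup>n (x + Q y)\<close> under the induced map of cones leaves
  \<open>Q (U\<^sup>n (f y + h x) + (1 + \<iota>) f c)\<close>, a nontorsion class coming from \<open>H\<^sub>*(C)\<close>.
\<close>

section \<open>Homology classes and fractions\<close>

text \<open>Closure of the boundaries together with the module laws makes \<open>hclass\<close> a
  quotient map with a scalar action. The locale is instantiated by the free complex, by its mapping
  cone and by the image of a self-local equivalence.\<close>

locale homology_complex =
  fixes K :: "'a::ab_group_add gr_complex"
  assumes zero_boundary: "0 \<in> boundaries K"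
    and add_boundary: "x \<in> boundaries K \<Longrightarrow> y \<in> boundaries K \<Longrightarrow> x + y \<in> boundaries K"
    and uminus_boundary: "x \<in> boundaries K \<Longrightarrow> - x \<in> boundaries K"
    and scal_boundary: "x \<in> boundaries K \<Longrightarrow> scal K p x \<in> boundaries K"
    and scal_add: "scal K p (x + y) = scal K p x + scal K p y"
    and scal_scal: "scal K p (scal K q x) = scal K (p * q) x"
    and scal_one: "scal K 1 x = x"
begin

lemma scal_diff: "scal K p (x - y) = scal K p x - scal K p y"
  using scal_add[of p "x - y" y] by simp

lemma hclass_eq_iff: "hclass K x = hclass K y \<longleftrightarrow> x - y \<in> boundaries K"
proof
  assume "hclass K x = hclass K y"
  moreover have "x \<in> hclass K x"
    unfolding hclass_def using zero_boundary by force
  ultimately obtain b where "x = y + b" "b \<in> boundaries K"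
    unfolding hclass_def by auto
  then show "x - y \<in> boundaries K"
    by simp
next
  have sub: "hclass K x \<subseteq> hclass K y" if "x - y \<in> boundaries K" for x y
  proof
    fix t assume "t \<in> hclass K x"
    then obtain b where "t = x + b" "b \<in> boundaries K"
      unfolding hclass_def by auto
    then have "t = y + ((x - y) + b)" "(x - y) + b \<in> boundaries K"
      using that add_boundary by auto
    then show "t \<in> hclass K y"
      unfolding hclass_def by blast
  qed
  assume "x - y \<in> boundaries K"
  moreover from this have "y - x \<in> boundaries K"
    using uminus_boundary by fastforce
  ultimately show "hclass K x = hclass K y"
    using sub by blast
qed

lemma hclass_zero: "hclass K 0 = boundaries K"
  unfolding hclass_def by auto

lemma hclass_eq_boundaries_iff: "hclass K x = boundaries K \<longleftrightarrow> x \<in> boundaries K"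
  using hclass_eq_iff[of x 0] by (simp add: hclass_zero)

lemma induced_hclass:
  assumes add: "\<And>x y. g (x + y) = g x + g y" and bd: "g ` boundaries K \<subseteq> boundaries K"
  shows "induced K g (hclass K x) = hclass K (g x)"
proof (intro equalityI subsetI)
  fix t assume "t \<in> induced K g (hclass K x)"
  then obtain b c where "t = g (x + b) + c" "b \<in> boundaries K" "c \<in> boundaries K"
    unfolding induced_def hclass_def by auto
  then have "t = g x + (g b + c)" "g b + c \<in> boundaries K"
    using add bd add_boundary by (auto simp: add.assoc)
  then show "t \<in> hclass K (g x)"
    unfolding hclass_def by blast
next
  fix t assume "t \<in> hclass K (g x)"
  then obtain b where "t = g (x + 0) + b" "b \<in> boundaries K"
    unfolding hclass_def by auto
  then show "t \<in> induced K g (hclass K x)"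
    unfolding induced_def hclass_def using zero_boundary by blast
qed

lemma hscal_hclass: "hscal K p (hclass K x) = hclass K (scal K p x)"
  unfolding hscal_def by (rule induced_hclass) (auto simp: scal_add scal_boundary)

lemma hscal_eq_boundaries_iff:
  "hscal K p (hclass K x) = boundaries K \<longleftrightarrow> scal K p x \<in> boundaries K"
  by (simp add: hscal_hclass hclass_eq_boundaries_iff)

section \<open>Equality of fractions in the localization\<close>

lemma frac_rel_iff:
  assumes "x \<in> cycles K" "y \<in> cycles K"
  shows "((hclass K x, m), (hclass K y, n)) \<in> frac_rel K \<longleftrightarrow>
    (\<exists>k. scal K (U ^ (k + n)) x - scal K (U ^ (k + m)) y \<in> boundaries K)"
  using assms by (auto simp: frac_rel_def homology_def hscal_hclass hclass_eq_iff)

lemma sym_frac_rel: "sym (frac_rel K)"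
proof (rule symI)
  fix a b assume "(a, b) \<in> frac_rel K"
  then obtain X m Y n k where "a = (X, m)" "b = (Y, n)" "X \<in> homology K" "Y \<in> homology K"
      "hscal K (U ^ (k + n)) X = hscal K (U ^ (k + m)) Y"
    unfolding frac_rel_def by blast
  then show "(b, a) \<in> frac_rel K"
    unfolding frac_rel_def by (metis (mono_tags, lifting) case_prodI mem_Collect_eq)
qed

lemma trans_frac_rel: "trans (frac_rel K)"
proof (rule transI)
  fix a b c assume ab: "(a, b) \<in> frac_rel K" and bc: "(b, c) \<in> frac_rel K"
  from ab obtain x m y n where 1: "a = (hclass K x, m)" "b = (hclass K y, n)"
      "x \<in> cycles K" "y \<in> cycles K"
    unfolding frac_rel_def homology_def by auto
  from bc obtain z p where 2: "c = (hclass K z, p)" "z \<in> cycles K"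
    unfolding frac_rel_def homology_def by auto
  from ab 1 obtain k where k: "scal K (U ^ (k + n)) x - scal K (U ^ (k + m)) y \<in> boundaries K"
    by (auto simp: frac_rel_iff)
  from bc 1 2 obtain j where j: "scal K (U ^ (j + p)) y - scal K (U ^ (j + n)) z \<in> boundaries K"
    by (auto simp: frac_rel_iff)
  \<comment> \<open>After this scaling the two terms in \<open>y\<close> carry the same power of
    \<open>U\<close> with opposite signs and cancel.\<close>
  have "scal K (U ^ (j + p)) (scal K (U ^ (k + n)) x - scal K (U ^ (k + m)) y)
      + scal K (U ^ (k + m)) (scal K (U ^ (j + p)) y - scal K (U ^ (j + n)) z) \<in> boundaries K"
    using k j by (intro add_boundary scal_boundary)
  then have "scal K (U ^ ((k + j + n) + p)) x - scal K (U ^ ((k + j + n) + m)) z \<in> boundaries K"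
    by (simp add: scal_diff scal_scal ac_simps flip: power_add)
  then show "(a, c) \<in> frac_rel K"
    using 1 2 by (auto simp: frac_rel_iff)
qed

lemma frac_eq_iff:
  assumes "x \<in> cycles K" "y \<in> cycles K"
  shows "frac K (hclass K x) m = frac K (hclass K y) n \<longleftrightarrow>
    (\<exists>k. scal K (U ^ (k + n)) x - scal K (U ^ (k + m)) y \<in> boundaries K)" (is "_ \<longleftrightarrow> ?r")
proof
  assume "frac K (hclass K x) m = frac K (hclass K y) n"
  moreover have "((hclass K y, n), (hclass K y, n)) \<in> frac_rel K"
    using assms by (auto simp: frac_rel_iff zero_boundary)
  ultimately have "((hclass K x, m), (hclass K y, n)) \<in> frac_rel K"
    unfolding frac_def by blast
  then show ?r
    using assms by (simp add: frac_rel_iff)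
next
  assume ?r
  then have xy: "((hclass K x, m), (hclass K y, n)) \<in> frac_rel K"
    using assms by (simp add: frac_rel_iff)
  then have yx: "((hclass K y, n), (hclass K x, m)) \<in> frac_rel K"
    using sym_frac_rel by (auto dest: symD)
  show "frac K (hclass K x) m = frac K (hclass K y) n"
    unfolding frac_def using xy yx trans_frac_rel by (blast dest: transD)
qed

lemma frac_in_loc: "x \<in> cycles K \<Longrightarrow> frac K (hclass K x) m \<in> loc K"
  unfolding loc_def frac_def homology_def by (auto intro: quotientI)

lemma loc_cases:
  assumes "c \<in> loc K"
  obtains x m where "x \<in> cycles K" "c = frac K (hclass K x) m"
  using assms unfolding loc_def quotient_def frac_def homology_def by auto

text \<open>\<open>loc_map\<close> is a union over all representatives of a fraction. A linear chain
  map sends equivalent representatives to equal fractions, so the union collapses to one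
  class.\<close>

lemma loc_map_frac:
  assumes x: "x \<in> cycles K" and add: "\<And>x y. g (x + y) = g x + g y"
    and bd: "g ` boundaries K \<subseteq> boundaries K" and cyc: "g ` cycles K \<subseteq> cycles K"
    and lin: "\<And>p x. g (scal K p x) = scal K p (g x)"
  shows "loc_map K g (frac K (hclass K x) m) = frac K (hclass K (g x)) m"
proof -
  have gdiff: "g (a - b) = g a - g b" for a b
    using add[of "a - b" b] by simp
  have "frac K (induced K g Y) n = frac K (hclass K (g x)) m"
    if "(Y, n) \<in> frac K (hclass K x) m" for Y n
  proof -
    have rel: "((hclass K x, m), (Y, n)) \<in> frac_rel K"
      using that unfolding frac_def by auto
    then obtain y where y: "Y = hclass K y" "y \<in> cycles K"
      unfolding frac_rel_def homology_def by auto
    from rel y x obtain k where "scal K (U ^ (k + n)) x - scal K (U ^ (k + m)) y \<in> boundaries K"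
      by (auto simp: frac_rel_iff)
    then have "g (scal K (U ^ (k + n)) x - scal K (U ^ (k + m)) y) \<in> boundaries K"
      using bd by blast
    then have "scal K (U ^ (k + n)) (g x) - scal K (U ^ (k + m)) (g y) \<in> boundaries K"
      by (simp add: gdiff lin)
    then have "frac K (hclass K (g x)) m = frac K (hclass K (g y)) n"
      using frac_eq_iff x y cyc by blast
    then show ?thesis
      by (simp add: y induced_hclass[OF add bd])
  qed
  moreover have "(hclass K x, m) \<in> frac K (hclass K x) m"
    using x by (auto simp: frac_def frac_rel_iff zero_boundary)
  ultimately show ?thesis
    unfolding loc_map_def by force
qed

end

section \<open>Gradings on free complexes\<close>

lemma bit_poly_vec_add_self: "x + x = (0 :: bit poly ^ 'n)"
proof -
  have "b + b = 0" for b :: bit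
    by (cases b) auto
  then show ?thesis
    unfolding vec_eq_iff poly_eq_iff vector_add_component coeff_add by simp
qed

lemma bit_poly_vec_uminus: "- x = (x :: bit poly ^ 'n)"
  using bit_poly_vec_add_self[of x] by (simp add: eq_neg_iff_add_eq_0 neg_eq_iff_add_eq_0)

lemma bit_poly_vec_diff: "x - y = x + (y :: bit poly ^ 'n)"
  using bit_poly_vec_uminus[of y] by (metis diff_conv_add_uminus)

lemma bit_poly_vec_add_eq_0_iff: "x + y = 0 \<longleftrightarrow> x = (y :: bit poly ^ 'n)"
  by (metis bit_poly_vec_diff eq_iff_diff_eq_0)

lemma bit_poly_vec_add_left_self: "x + (x + y) = (y :: bit poly ^ 'n)"
  by (simp add: bit_poly_vec_add_self flip: add.assoc)

text \<open>\<open>bit_poly_vec_add_left_self\<close> cancels equal neighbours inside right-nested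
  sums, so that after AC rewriting every summand occurring twice disappears.\<close>

lemmas bit_poly_vec_simps =
  bit_poly_vec_add_self bit_poly_vec_add_left_self ac_simps

section \<open>Powers of \<open>U\<close> and homogeneous vectors\<close>

lemma U_power: "U ^ k = monom 1 k"
  by (simp add: U_def monom_power)

lemma U_power_smult_eq_0_iff: "U ^ k *s (x :: bit poly ^ 'n) = 0 \<longleftrightarrow> x = 0"
  by (simp add: vec_eq_iff U_power monom_eq_0_iff)

text \<open>The field \<open>homog\<close> of \<open>free_complex\<close>, separated from the
  differential.\<close>

definition homogeneous :: "('n \<Rightarrow> rat) \<Rightarrow> rat \<Rightarrow> (bit poly ^ 'n::finite) set" where
  "homogeneous gr r = {x. \<forall>i k. coeff (x $ i) k \<noteq> 0 \<longrightarrow> gr i - 2 * of_nat k = r}"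

lemma homogeneousD: "x \<in> homogeneous gr r \<Longrightarrow> coeff (x $ i) k \<noteq> 0 \<Longrightarrow> gr i - 2 * of_nat k = r"
  by (simp add: homogeneous_def)

lemma homogeneous_zero: "0 \<in> homogeneous gr r"
  by (simp add: homogeneous_def)

lemma homogeneous_add: "x \<in> homogeneous gr r \<Longrightarrow> y \<in> homogeneous gr r \<Longrightarrow> x + y \<in> homogeneous gr r"
  unfolding homogeneous_def mem_Collect_eq vector_add_component coeff_add by force

lemma homogeneous_degree:
  assumes "x \<in> homogeneous gr r" "x \<noteq> 0"
  obtains i k where "r = gr i - 2 * of_nat k"
  using assms unfolding homogeneous_def vec_eq_iff poly_eq_iff by fastforce

lemma homogeneous_U_power:
  assumes "x \<in> homogeneous gr r"
  shows "U ^ k *s x \<in> homogeneous gr (r - 2 * of_nat k)"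
  unfolding homogeneous_def
proof (clarify)
  fix i j assume "coeff ((U ^ k *s x) $ i) j \<noteq> 0"
  then have "k \<le> j" "coeff (x $ i) (j - k) \<noteq> 0"
    by (auto simp: U_power coeff_monom_mult split: if_splits)
  with homogeneousD[OF assms this(2)] show "gr i - 2 * of_nat j = r - 2 * of_nat k"
    by (simp add: of_nat_diff)
qed

text \<open>In degree \<open>s - 2 * of_nat k\<close>, with \<open>s\<close> below all gradings of
  the basis, a basis element can occur only with a power of \<open>U\<close> of at least
  \<open>k\<close>. Hence \<open>U ^ k\<close> can be divided out coordinatewise.\<close>

lemma homogeneous_divisible:
  assumes x: "x \<in> homogeneous gr (s - 2 * of_nat k)" and s: "\<And>i. s \<le> gr i"
  obtains y where "y \<in> homogeneous gr s" "x = U ^ k *s y"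
proof
  let ?y = "\<chi> i. poly_shift k (x $ i)"
  show "?y \<in> homogeneous gr s"
    unfolding homogeneous_def using homogeneousD[OF x] by (fastforce simp: coeff_poly_shift)
  have "coeff (x $ i) j = 0" if "j < k" for i j
  proof (rule ccontr)
    assume "coeff (x $ i) j \<noteq> 0"
    then have "gr i - 2 * of_nat j = s - 2 * of_nat k"
      by (rule homogeneousD[OF x])
    moreover have "(of_nat j :: rat) < of_nat k"
      using that by simp
    ultimately show False
      using s[of i] by linarith
  qed
  then show "x = U ^ k *s ?y"
    by (auto simp: vec_eq_iff poly_eq_iff U_power coeff_monom_mult coeff_poly_shift)
qed

section \<open>Homogeneous components and graded maps\<close>

definition component :: "('n \<Rightarrow> rat) \<Rightarrow> rat \<Rightarrow> bit poly ^ 'n \<Rightarrow> bit poly ^ 'n::finite" where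
  "component gr r x =
     (\<chi> i. Abs_poly (\<lambda>k. if gr i - 2 * of_nat k = r then coeff (x $ i) k else 0))"

lemma coeff_component:
  "coeff (component gr r x $ i) k = (if gr i - 2 * of_nat k = r then coeff (x $ i) k else 0)"
proof -
  \<comment> \<open>Projecting only replaces coefficients by zero, so almost all still vanish and
    \<open>Abs_poly\<close> is inverted by \<open>coeff\<close>.\<close>
  have "\<forall>\<^sub>\<infinity>k. (if gr i - 2 * of_nat k = r then coeff (x $ i) k else 0) = 0"
    using MOST_coeff_eq_0[of "x $ i"] by (rule MOST_mono) simp
  then show ?thesis
    by (simp add: component_def Abs_poly_inverse)
qed

lemma component_homogeneous: "component gr r x \<in> homogeneous gr r"
  by (auto simp: homogeneous_def coeff_component)

lemma component_of_homogeneous: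
  "x \<in> homogeneous gr s \<Longrightarrow> component gr r x = (if r = s then x else 0)"
  by (force simp: vec_eq_iff poly_eq_iff coeff_component dest: homogeneousD)

lemma component_zero: "component gr r 0 = 0"
  by (simp add: vec_eq_iff poly_eq_iff coeff_component)

lemma component_add: "component gr r (x + y) = component gr r x + component gr r y"
  by (simp add: vec_eq_iff poly_eq_iff coeff_component)

lemma component_sum: "component gr r (\<Sum>i\<in>I. x i) = (\<Sum>i\<in>I. component gr r (x i))"
  by (induction I rule: infinite_finite_induct) (auto simp: component_zero component_add)

lemma sum_components:
  fixes gr :: "'n::finite \<Rightarrow> rat"
  obtains R where "finite R" "x = (\<Sum>r\<in>R. component gr r x)"
proof
  \<comment> \<open>All degrees in which a monomial of \<open>x\<close> can lie.\<close>
  let ?R = "\<Union>i. (\<lambda>k. gr i - 2 * of_nat k) ` {..degree (x $ i)}"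
  show fin: "finite ?R"
    by auto
  have "coeff (x $ i) k = (\<Sum>r\<in>?R. coeff (component gr r x $ i) k)" for i k
  proof (cases "coeff (x $ i) k = 0")
    case True
    then show ?thesis
      by (simp add: coeff_component)
  next
    case False
    then have "gr i - 2 * of_nat k \<in> ?R"
      using le_degree by fastforce
    then show ?thesis
      using fin by (simp add: coeff_component)
  qed
  then show "x = (\<Sum>r\<in>?R. component gr r x)"
    by (simp add: vec_eq_iff poly_eq_iff coeff_sum sum_component)
qed

text \<open>By additivity it suffices to look at homogeneous summands, where the claim is the degree
  shift by \<open>e\<close>. This is the device for making witnesses homogeneous.\<close>

lemma component_graded_map:
  fixes g :: "bit poly ^ 'n::finite \<Rightarrow> bit poly ^ 'm::finite"
  assumes add: "\<And>x y. g (x + y) = g x + g y"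
    and gr: "\<And>r. g ` homogeneous gr r \<subseteq> homogeneous gr' (r + e)"
  shows "component gr' (s + e) (g x) = g (component gr s x)"
proof -
  have g0: "g 0 = 0"
    using add[of 0 0] by simp
  have gsum: "g (\<Sum>r\<in>R. y r) = (\<Sum>r\<in>R. g (y r))" for R and y :: "rat \<Rightarrow> _"
    by (induction R rule: infinite_finite_induct) (auto simp: g0 add)
  obtain R where R: "finite R" "x = (\<Sum>r\<in>R. component gr r x)"
    by (rule sum_components)
  have comp: "component gr' (s + e) (g (component gr r x)) = g (component gr s (component gr r x))" for r
  proof -
    have "g (component gr r x) \<in> homogeneous gr' (r + e)"
      using gr component_homogeneous by blast
    then show ?thesis
      by (simp add: component_of_homogeneous[OF component_homogeneous] component_of_homogeneous g0)
  qed
  have "component gr' (s + e) (g x) = component gr' (s + e) (g (\<Sum>r\<in>R. component gr r x))"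
    using R by simp
  also have "\<dots> = g (component gr s (\<Sum>r\<in>R. component gr r x))"
    by (simp add: gsum component_sum comp)
  finally show ?thesis
    using R by simp
qed


text \<open>The degree \<open>e\<close> is \<open>0\<close> for chain maps, \<open>1\<close> for
  homotopies and \<open>- 1\<close> for the differential.\<close>

definition graded_hom ::
  "('n \<Rightarrow> rat) \<Rightarrow> rat \<Rightarrow> (bit poly ^ 'n \<Rightarrow> bit poly ^ 'n::finite) \<Rightarrow> bool" where
  "graded_hom gr e g \<longleftrightarrow> (\<forall>x y. g (x + y) = g x + g y) \<and> (\<forall>p x. g (p *s x) = p *s g x) \<and>
     (\<forall>r. g ` homogeneous gr r \<subseteq> homogeneous gr (r + e))"

lemma graded_hom_add: "graded_hom gr e g \<Longrightarrow> g (x + y) = g x + g y"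
  and graded_hom_scale: "graded_hom gr e g \<Longrightarrow> g (p *s x) = p *s g x"
  and graded_hom_homogeneous:
    "graded_hom gr e g \<Longrightarrow> x \<in> homogeneous gr r \<Longrightarrow> g x \<in> homogeneous gr (r + e)"
  by (auto simp: graded_hom_def image_subset_iff)

lemma graded_hom_zero: "graded_hom gr e g \<Longrightarrow> g 0 = 0"
  using graded_hom_add[of gr e g 0 0] by simp

lemma graded_hom_comp: "graded_hom gr e g \<Longrightarrow> graded_hom gr e' g' \<Longrightarrow> graded_hom gr (e + e') (g' \<circ> g)"
  unfolding graded_hom_def by (simp add: image_subset_iff flip: add.assoc)

lemma graded_hom_component:
  "graded_hom gr e g \<Longrightarrow> component gr (s + e) (g x) = g (component gr s x)"
  by (rule component_graded_map) (auto simp: graded_hom_def)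

text \<open>The degree \<open>r\<close> component of \<open>x\<close> maps to the degree
  \<open>r + e\<close> component of \<open>g x\<close>, which is all of \<open>g x\<close>.
  Primitives can thus be chosen homogeneous.\<close>

lemma graded_hom_preimage:
  assumes g: "graded_hom gr e g" and y: "g x \<in> homogeneous gr (r + e)"
  obtains x' where "x' \<in> homogeneous gr r" "g x = g x'"
proof
  show "component gr r x \<in> homogeneous gr r"
    by (rule component_homogeneous)
  show "g x = g (component gr r x)"
    using y graded_hom_component[OF g, of r x] by (simp add: component_of_homogeneous)
qed

text \<open>Finitely many descending progressions of step two have finitely many members above
  \<open>r0\<close>, so a maximum exists. This gives \<open>GREATEST\<close> in the correction terms
  its intended meaning.\<close>

lemma Greatest_degree:
  fixes P :: "rat \<Rightarrow> bool"
  assumes r0: "P r0" and A: "finite A" and deg: "\<And>r. P r \<Longrightarrow> \<exists>a\<in>A. \<exists>k. r = a - 2 * of_nat k"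
  shows "P (GREATEST r. P r)" and "P r \<Longrightarrow> r \<le> (GREATEST r. P r)"
proof -
  define S where "S = {r. P r \<and> r0 \<le> r}"
  have "S \<subseteq> (\<Union>a\<in>A. (\<lambda>k. a - 2 * of_nat k) ` {..nat \<lceil>a - r0\<rceil>})"
  proof
    fix r assume r: "r \<in> S"
    then obtain a k where ak: "a \<in> A" "r = a - 2 * of_nat k"
      using deg unfolding S_def by blast
    then have "(of_nat k :: rat) \<le> a - r0"
      using r by (simp add: S_def)
    then have "k \<le> nat \<lceil>a - r0\<rceil>"
      by linarith
    then show "r \<in> (\<Union>a\<in>A. (\<lambda>k. a - 2 * of_nat k) ` {..nat \<lceil>a - r0\<rceil>})"
      using ak by auto
  qed
  then have fin: "finite S"
    by (rule finite_subset) (use A in auto)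
  have "r0 \<in> S"
    using r0 by (simp add: S_def)
  then have max: "Max S \<in> S" "r0 \<le> Max S"
    using fin Max_in by auto
  have ub: "r \<le> Max S" if "P r" for r
    using that fin max(2) by (cases "r0 \<le> r") (auto simp: S_def)
  have eq: "(GREATEST r. P r) = Max S"
    by (rule Greatest_equality) (use max ub in \<open>auto simp: S_def\<close>)
  show "P (GREATEST r. P r)"
    using max by (simp add: eq S_def)
  show "P r \<Longrightarrow> r \<le> (GREATEST r. P r)"
    by (simp add: eq ub)
qed

section \<open>Torsion in the homology of a free complex\<close>

lemma homog_free_complex: "homog (free_complex gr d) r = homogeneous gr r"
  by (simp add: free_complex_def homogeneous_def)

lemma free_complex_simps:
  "elts (free_complex gr d) = UNIV" "scal (free_complex gr d) p x = p *s x"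
  "bdry (free_complex gr d) = d"
  by (simp_all add: free_complex_def)

lemma chain_map_free_complex:
  "chain_map (free_complex gr d) g \<Longrightarrow> graded_hom gr 0 g \<and> (\<forall>x. g (d x) = d (g x))"
  by (simp add: chain_map_def module_hom_iff graded_hom_def homog_free_complex free_complex_simps)

lemma homotopic_free_complex:
  assumes "homotopic (free_complex gr d) g g'"
  obtains h where "graded_hom gr 1 h" "\<And>x. g x + g' x = d (h x) + h (d x)"
  using assms
  by (auto simp: homotopic_def module_hom_iff graded_hom_def homog_free_complex free_complex_simps
      bit_poly_vec_diff)

locale free_gr_complex =
  fixes gr :: "'n::finite \<Rightarrow> rat" and d :: "bit poly ^ 'n \<Rightarrow> bit poly ^ 'n"
  assumes chain_complex: "chain_complex (free_complex gr d)"
begin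

abbreviation C where "C \<equiv> free_complex gr d"

lemma d_graded: "graded_hom gr (- 1) d"
  using chain_complex
  by (auto simp: chain_complex_def module_hom_iff graded_hom_def homog_free_complex free_complex_simps)

lemmas d_add = graded_hom_add[OF d_graded]
lemmas d_scale = graded_hom_scale[OF d_graded]
lemmas d_zero = graded_hom_zero[OF d_graded]

lemma range_d_add: "x \<in> range d \<Longrightarrow> y \<in> range d \<Longrightarrow> x + y \<in> range d"
  by (auto simp flip: d_add)

lemma range_d_scale: "x \<in> range d \<Longrightarrow> p *s x \<in> range d"
  by (auto simp flip: d_scale)

lemma zero_range_d: "0 \<in> range d"
  by (metis d_zero rangeI)

lemma range_d_homogeneous:
  assumes "y \<in> range d" "y \<in> homogeneous gr r"
  obtains x where "x \<in> homogeneous gr (r + 1)" "y = d x"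
proof -
  obtain x where x: "y = d x"
    using assms by auto
  with assms(2) show thesis
    using graded_hom_preimage[OF d_graded, of x "r + 1"] that by auto
qed

lemma boundaries_C: "boundaries C = range d"
  by (simp add: boundaries_def free_complex_simps)

lemma cycles_C: "cycles C = {x. d x = 0}"
  by (simp add: cycles_def free_complex_simps)

sublocale C: homology_complex C
  by unfold_locales
    (auto simp: boundaries_C free_complex_simps range_d_add range_d_scale bit_poly_vec_uminus
      vector_add_ldistrib vector_smult_assoc zero_range_d)

text \<open>For a cycle this says that its homology class is \<open>U\<close>-torsion. Working with
  chains instead of cosets lets representatives be added and scaled directly.\<close>

definition torsion :: "bit poly ^ 'n \<Rightarrow> bool" where
  "torsion x \<longleftrightarrow> (\<exists>k. U ^ k *s x \<in> range d)"

lemma torsion_add: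
  assumes "torsion x" "torsion y"
  shows "torsion (x + y)"
proof -
  obtain k j where "U ^ k *s x \<in> range d" "U ^ j *s y \<in> range d"
    using assms by (auto simp: torsion_def)
  then have "U ^ j *s (U ^ k *s x) + U ^ k *s (U ^ j *s y) \<in> range d"
    by (intro range_d_add) (simp_all only: range_d_scale)
  then have "U ^ (k + j) *s (x + y) \<in> range d"
    by (simp add: vector_add_ldistrib power_add mult.commute vector_smult_assoc)
  then show ?thesis
    by (auto simp: torsion_def)
qed

lemma torsion_range_d: "x \<in> range d \<Longrightarrow> torsion x"
  unfolding torsion_def by (rule exI[of _ 0]) simp

lemma torsion_U_power_iff: "torsion (U ^ k *s x) \<longleftrightarrow> torsion x"
proof
  assume "torsion (U ^ k *s x)"
  then obtain j where "U ^ j *s (U ^ k *s x) \<in> range d"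
    by (auto simp: torsion_def)
  then have "U ^ (j + k) *s x \<in> range d"
    by (simp add: power_add vector_smult_assoc)
  then show "torsion x"
    by (auto simp: torsion_def)
next
  assume "torsion x"
  then obtain j where "U ^ j *s x \<in> range d"
    by (auto simp: torsion_def)
  then have "U ^ k *s (U ^ j *s x) \<in> range d"
    by (rule range_d_scale)
  then show "torsion (U ^ k *s x)"
    by (auto simp: torsion_def mult.commute vector_smult_assoc)
qed

lemma torsion_add_cancel: "torsion (x + y) \<Longrightarrow> torsion y \<Longrightarrow> torsion x"
  using torsion_add[of "x + y" y] by (simp add: add.assoc bit_poly_vec_add_self)

lemma torsion_chain_map:
  assumes "graded_hom gr e g" "\<And>x. g (d x) = d (g x)" "torsion x"
  shows "torsion (g x)"
  using assms unfolding torsion_def by (metis graded_hom_scale rangeE rangeI)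

text \<open>Translates the localization into \<open>torsion\<close>. In the comparison with zero the
  denominator \<open>m\<close> multiplies only the zero class and drops out.\<close>

lemma frac_eq_zero_iff:
  assumes "d x = 0"
  shows "frac C (hclass C x) m = frac C (hclass C 0) 0 \<longleftrightarrow> torsion x"
  using C.frac_eq_iff[of x 0 m 0] assms
  by (simp add: cycles_C d_zero free_complex_simps boundaries_C torsion_def)

text \<open>The degrees met by the infinite \<open>U\<close>-tower in homology.\<close>

definition tower :: "rat \<Rightarrow> bool" where
  "tower r \<longleftrightarrow> (\<exists>x\<in>homogeneous gr r. d x = 0 \<and> \<not> torsion x)"

lemma tower_degree: "tower r \<Longrightarrow> \<exists>a\<in>range gr. \<exists>k. r = a - 2 * of_nat k"
  unfolding tower_def
  by (metis homogeneous_degree rangeI torsion_range_d d_zero)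

lemma d_inv_eq: "d_inv C = (GREATEST r. tower r) + 2"
proof -
  have "(\<forall>n. hscal C (U ^ n) (hclass C x) \<noteq> boundaries C) \<longleftrightarrow> \<not> torsion x" for x
    by (simp only: C.hscal_eq_boundaries_iff) (simp add: torsion_def boundaries_C free_complex_simps)
  then have "(\<exists>X\<in>homology_deg C r. \<forall>n. hscal C (U ^ n) X \<noteq> boundaries C) \<longleftrightarrow> tower r" for r
    by (auto simp: homology_deg_def tower_def cycles_C homog_free_complex)
  then show ?thesis
    by (simp add: d_inv_def)
qed

end

section \<open>Consequences of the Laurent localization\<close>

locale laurent_complex = free_gr_complex +
  assumes laurent: "loc_is_laurent C"
begin

text \<open>If all cycles were torsion, the localization would be a single point, while the Laurent
  ring has \<open>0\<close> and \<open>1\<close> distinct.\<close>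

lemma ex_nontorsion: "\<exists>x. d x = 0 \<and> \<not> torsion x"
proof (rule ccontr)
  assume "\<not> ?thesis"
  then have "c = frac C (hclass C 0) 0" if "c \<in> loc C" for c
    using that by (elim C.loc_cases) (auto simp: cycles_C frac_eq_zero_iff)
  moreover obtain \<phi> :: "_ \<Rightarrow> int \<Rightarrow>\<^sub>0 bit" where "bij_betw \<phi> (loc C) UNIV"
    using laurent unfolding loc_is_laurent_def by auto
  ultimately have "p = \<phi> (frac C (hclass C 0) 0)" for p
    unfolding bij_betw_def by (metis (no_types, lifting) UNIV_I imageE)
  then show False
    by (metis zero_neq_one)
qed

text \<open>The components of a nontorsion cycle are cycles, because \<open>d\<close> is graded.
  They cannot all be torsion, since finite sums of torsion elements are torsion.\<close>

lemma ex_tower: "\<exists>r. tower r"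
proof (rule ccontr)
  assume no: "\<not> ?thesis"
  obtain x where x: "d x = 0" "\<not> torsion x"
    using ex_nontorsion by auto
  obtain R where R: "finite R" "x = (\<Sum>r\<in>R. component gr r x)"
    by (rule sum_components)
  have "d (component gr r x) = 0" for r
    using graded_hom_component[OF d_graded, of r x] x by (simp add: component_zero)
  then have tors: "torsion (component gr r x)" for r
    using no component_homogeneous unfolding tower_def by blast
  have "torsion (\<Sum>r\<in>S. component gr r x)" for S
    by (induction S rule: infinite_finite_induct)
      (simp_all add: torsion_add tors torsion_range_d zero_range_d)
  then show False
    using R x by metis
qed

lemma tower_Greatest: "tower (GREATEST r. tower r)"
  and tower_le_Greatest: "tower r \<Longrightarrow> r \<le> (GREATEST r. tower r)"
  using ex_tower Greatest_degree[of tower _ "range gr"] tower_degree by auto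

text \<open>In each degree the localization has at most one nonzero element.\<close>

lemma torsion_add_nontorsion:
  assumes x: "x \<in> homogeneous gr r" "d x = 0" "\<not> torsion x"
    and y: "y \<in> homogeneous gr r" "d y = 0" "\<not> torsion y"
  shows "torsion (x + y)"
proof -
  obtain \<phi> :: "_ \<Rightarrow> int \<Rightarrow>\<^sub>0 bit" and \<tau> where bij: "bij_betw \<phi> (loc C) UNIV"
    and add: "\<forall>X\<in>homology C. \<forall>Y\<in>homology C. \<forall>m n.
       \<phi> (frac C (hadd (hscal C (U ^ n) X) (hscal C (U ^ m) Y)) (m + n)) =
       \<phi> (frac C X m) + \<phi> (frac C Y n)"
    and deg: "\<forall>r. \<forall>X\<in>homology_deg C r. \<forall>m. \<forall>k\<in>Poly_Mapping.keys (\<phi> (frac C X m)).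
       \<tau> - 2 * of_int k = r + 2 * of_nat m"
    using laurent unfolding loc_is_laurent_def by auto
  define \<psi> where "\<psi> z = \<phi> (frac C (hclass C z) 0)" for z
  have inj: "\<psi> a = \<psi> b \<longleftrightarrow> frac C (hclass C a) 0 = frac C (hclass C b) 0"
    if "d a = 0" "d b = 0" for a b
    unfolding \<psi>_def using that
    by (intro inj_on_eq_iff[OF bij_betw_imp_inj_on[OF bij]] C.frac_in_loc) (auto simp: cycles_C)
  \<comment> \<open>The additivity clause is instantiated at two copies of the zero class with
    exponent \<open>0\<close>, giving \<open>\<psi> 0 = \<psi> 0 + \<psi> 0\<close>.\<close>
  have h0: "hscal C (U ^ 0) (hclass C 0) = boundaries C"
    by (simp only: C.hscal_eq_boundaries_iff power_0 C.scal_one C.zero_boundary)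
  have "hadd (boundaries C) (boundaries C) = boundaries C"
  proof
    show "hadd (boundaries C) (boundaries C) \<subseteq> boundaries C"
      by (auto simp: hadd_def intro: C.add_boundary)
    show "boundaries C \<subseteq> hadd (boundaries C) (boundaries C)"
    proof
      fix b assume "b \<in> boundaries C"
      then show "b \<in> hadd (boundaries C) (boundaries C)"
        unfolding hadd_def mem_Collect_eq
        by (intro exI[of _ b] exI[of _ 0]) (simp only: add_0_right C.zero_boundary simp_thms)
    qed
  qed
  then have "\<phi> (frac C (hadd (hscal C (U ^ 0) (hclass C 0)) (hscal C (U ^ 0) (hclass C 0))) (0 + 0)) = \<psi> 0"
    unfolding h0 by (simp only: \<psi>_def C.hclass_zero add_0)
  moreover have "hclass C 0 \<in> homology C"
    by (simp add: homology_def cycles_C d_zero)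
  ultimately have "\<psi> 0 = \<psi> 0 + \<psi> 0"
    using add unfolding \<psi>_def by metis
  then have zero: "\<psi> 0 = 0"
    by (simp only: add_cancel_right_right)
  \<comment> \<open>By the grading clause every exponent \<open>k\<close> in the support satisfies
    \<open>\<tau> - 2 * of_int k = r\<close>, so the nonempty support is one point determined by
    \<open>r\<close>.\<close>
  have key: "\<exists>k. Poly_Mapping.keys (\<psi> z) = {k} \<and> \<tau> - 2 * of_int k = r"
    if "z \<in> homogeneous gr r" "d z = 0" "\<not> torsion z" for z
  proof -
    have "\<psi> z \<noteq> 0"
      using inj[of z 0] frac_eq_zero_iff[of z] that by (simp add: zero d_zero)
    then obtain k where k: "k \<in> Poly_Mapping.keys (\<psi> z)"
      by (metis all_not_in_conv keys_eq_empty)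
    have eq: "\<tau> - 2 * of_int j = r" if "j \<in> Poly_Mapping.keys (\<psi> z)" for j
      using deg[rule_format, of "hclass C z" r j 0] that \<open>z \<in> _\<close> \<open>d z = 0\<close>
      by (auto simp: homology_deg_def cycles_C homog_free_complex \<psi>_def)
    have "j = k" if "j \<in> Poly_Mapping.keys (\<psi> z)" for j
    proof -
      have "(of_int j :: rat) = of_int k"
        using eq[OF that] eq[OF k] by linarith
      then show ?thesis
        by simp
    qed
    then show ?thesis
      using k eq by blast
  qed
  obtain k where "Poly_Mapping.keys (\<psi> x) = {k}" "Poly_Mapping.keys (\<psi> y) = {k}"
    using key[OF x] key[OF y] by fastforce
  then have "Poly_Mapping.keys (\<psi> x) = Poly_Mapping.keys (\<psi> y)"
    by simp
  then have supp: "Poly_Mapping.lookup (\<psi> x) i = 0 \<longleftrightarrow> Poly_Mapping.lookup (\<psi> y) i = 0" for i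
    by (metis Poly_Mapping.in_keys_iff)
  \<comment> \<open>Over the field with two elements a Laurent polynomial is determined by its
    support.\<close>
  have "\<psi> x = \<psi> y"
  proof (rule poly_mapping_eqI)
    show "Poly_Mapping.lookup (\<psi> x) i = Poly_Mapping.lookup (\<psi> y) i" for i
      using supp[of i] by (cases "Poly_Mapping.lookup (\<psi> x) i"; cases "Poly_Mapping.lookup (\<psi> y) i") simp_all
  qed
  then obtain k where "U ^ k *s x - U ^ k *s y \<in> range d"
    using inj[OF x(2) y(2)] C.frac_eq_iff[of x y 0 0] x y
    by (auto simp: cycles_C free_complex_simps boundaries_C)
  then show ?thesis
    by (auto simp: torsion_def bit_poly_vec_diff vector_add_ldistrib)
qed

end

section \<open>The mapping cone of an iota-complex\<close>

locale iota_gr_complex = laurent_complex gr d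
  for gr :: "'n::finite \<Rightarrow> rat" and d :: "bit poly ^ 'n \<Rightarrow> bit poly ^ 'n" +
  fixes \<iota> :: "bit poly ^ 'n \<Rightarrow> bit poly ^ 'n"
  assumes chain_map_iota: "chain_map C \<iota>"
    and iota_iota: "homotopic C (\<iota> \<circ> \<iota>) id"
begin

lemma iota_graded: "graded_hom gr 0 \<iota>"
  and iota_d: "\<iota> (d x) = d (\<iota> x)"
  using chain_map_free_complex[OF chain_map_iota] by auto

lemmas iota_add = graded_hom_add[OF iota_graded]
lemmas iota_scale = graded_hom_scale[OF iota_graded]

lemma iota_homogeneous: "x \<in> homogeneous gr r \<Longrightarrow> \<iota> x \<in> homogeneous gr r"
  using graded_hom_homogeneous[OF iota_graded] by fastforce

lemma torsion_iota: "torsion x \<Longrightarrow> torsion (\<iota> x)"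
  by (rule torsion_chain_map[OF iota_graded]) (rule iota_d)

text \<open>If \<open>x\<close> is nontorsion, so is \<open>\<iota> x\<close>: otherwise
  \<open>\<iota> (\<iota> x)\<close>, which is homologous to \<open>x\<close>, would be torsion. Two
  nontorsion cycles of the same degree have torsion sum.\<close>

lemma torsion_add_iota:
  assumes x: "x \<in> homogeneous gr r" "d x = 0"
  shows "torsion (x + \<iota> x)"
proof -
  have dix: "d (\<iota> x) = 0"
    using x iota_d[of x] graded_hom_zero[OF iota_graded] by simp
  show ?thesis
  proof (cases "torsion x")
    case True
    then show ?thesis
      by (intro torsion_add torsion_iota)
  next
    case False
    obtain h where h: "graded_hom gr 1 h" "\<And>x. (\<iota> \<circ> \<iota>) x + id x = d (h x) + h (d x)"
      by (rule homotopic_free_complex[OF iota_iota]) (rule that; assumption)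
    have "\<not> torsion (\<iota> x)"
    proof
      assume "torsion (\<iota> x)"
      then have "torsion (\<iota> (\<iota> x))"
        by (rule torsion_iota)
      moreover have "x + \<iota> (\<iota> x) = d (h x)"
        using h(2)[of x] x graded_hom_zero[OF h(1)] by (simp add: add.commute)
      then have "torsion (x + \<iota> (\<iota> x))"
        by (simp add: torsion_range_d)
      ultimately show False
        using False torsion_add_cancel by blast
    qed
    then show ?thesis
      using torsion_add_nontorsion x False iota_homogeneous dix by blast
  qed
qed

section \<open>Cycles, boundaries and \<open>Q\<close> in the mapping cone\<close>

abbreviation I where "I \<equiv> CFI C \<iota>"

lemma CFI_simps:
  "elts I = UNIV" "scal I p (x, y) = (p *s x, p *s y)"
  "homog I r = homogeneous gr (r - 1) \<times> homogeneous gr r"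
  "bdry I (x, y) = (d x, x + \<iota> x + d y)"
  by (simp_all add: CFI_def free_complex_simps homog_free_complex)

lemma boundaries_I: "(x, y) \<in> boundaries I \<longleftrightarrow> (\<exists>a b. x = d a \<and> y = a + \<iota> a + d b)"
  by (auto simp: boundaries_def CFI_simps image_iff)

lemma boundaries_I_cases:
  assumes "z \<in> boundaries I"
  obtains a b where "z = (d a, a + \<iota> a + d b)"
  using assms by (auto simp: boundaries_def CFI_simps)

text \<open>In characteristic two the second cone equation makes \<open>y\<close> a primitive of
  \<open>x + \<iota> x\<close>. Lifting a cycle \<open>x\<close> to the cone thus means bounding
  \<open>x + \<iota> x\<close>.\<close>

lemma cycles_I: "(x, y) \<in> cycles I \<longleftrightarrow> d x = 0 \<and> x + \<iota> x = d y"
  by (simp add: cycles_def CFI_simps bit_poly_vec_add_eq_0_iff zero_prod_def)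

sublocale I: homology_complex I
proof
  have z: "d 0 = 0" "\<iota> 0 = 0"
    using d_zero graded_hom_zero[OF iota_graded] by auto
  show "0 \<in> boundaries I"
    unfolding zero_prod_def boundaries_I by (intro exI[of _ 0]) (simp add: z)
  show add: "x + y \<in> boundaries I" if "x \<in> boundaries I" "y \<in> boundaries I" for x y
  proof -
    obtain a b where x: "x = (d a, a + \<iota> a + d b)"
      using \<open>x \<in> boundaries I\<close> by (rule boundaries_I_cases)
    obtain a' b' where y: "y = (d a', a' + \<iota> a' + d b')"
      using \<open>y \<in> boundaries I\<close> by (rule boundaries_I_cases)
    have "x + y = (d (a + a'), (a + a') + \<iota> (a + a') + d (b + b'))"
      by (simp add: x y d_add iota_add ac_simps)
    moreover have "\<dots> \<in> boundaries I"
      unfolding boundaries_I by blast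
    ultimately show ?thesis
      by simp
  qed
  show "- x \<in> boundaries I" if "x \<in> boundaries I" for x
    using that by (cases x) (simp add: bit_poly_vec_uminus)
  show "scal I p x \<in> boundaries I" if "x \<in> boundaries I" for p x
  proof -
    obtain a b where x: "x = (d a, a + \<iota> a + d b)"
      using \<open>x \<in> boundaries I\<close> by (rule boundaries_I_cases)
    have "scal I p x = (d (p *s a), p *s a + \<iota> (p *s a) + d (p *s b))"
      by (simp add: x CFI_simps d_scale iota_scale vector_add_ldistrib)
    moreover have "\<dots> \<in> boundaries I"
      unfolding boundaries_I by blast
    ultimately show ?thesis
      by simp
  qed
  show "scal I p (x + y) = scal I p x + scal I p y" for p x y
    by (cases x; cases y) (simp add: CFI_simps vector_add_ldistrib)
  show "scal I p (scal I q x) = scal I (p * q) x" for p q x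
    by (cases x) (simp add: CFI_simps vector_smult_assoc)
  show "scal I 1 x = x" for x
    by (cases x) (simp add: CFI_simps)
qed

text \<open>\<open>Q\<close> sends a boundary with first coordinate \<open>d x\<close> to
  \<open>(0, d x)\<close>, the boundary of \<open>(0, x)\<close>, and so descends to
  classes.\<close>

lemma induced_Q: "induced I Q (hclass I (x, y)) = hclass I (0, x)"
proof -
  have "Q ` boundaries I \<subseteq> boundaries I"
  proof (rule image_subsetI)
    fix z assume "z \<in> boundaries I"
    moreover obtain a b where z: "z = (a, b)"
      by (cases z)
    ultimately have "(a, b) \<in> boundaries I"
      by simp
    then obtain x where "a = d x"
      by (auto simp: boundaries_I)
    moreover have "(0, d x) \<in> boundaries I"
      unfolding boundaries_I
      by (intro exI[of _ 0] exI[of _ x]) (simp add: d_zero graded_hom_zero[OF iota_graded])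
    ultimately show "Q z \<in> boundaries I"
      by (simp add: Q_def z)
  qed
  then have "induced I Q (hclass I (x, y)) = hclass I (Q (x, y))"
    by (intro I.induced_hclass) (auto simp: Q_def)
  then show ?thesis
    by (simp add: Q_def)
qed

text \<open>A bounding of \<open>(0, x)\<close> writes \<open>x\<close> as
  \<open>a + \<iota> a\<close> plus a boundary, with \<open>a\<close> a cycle. In degree
  \<open>r\<close> both terms are torsion.\<close>

lemma nontorsion_Q:
  assumes x: "x \<in> homogeneous gr r" "\<not> torsion x"
  shows "(0, x) \<notin> boundaries I"
proof
  assume "(0, x) \<in> boundaries I"
  then obtain a b where a: "d a = 0" and xab: "x = a + \<iota> a + d b"
    by (auto simp: boundaries_I)
  \<comment> \<open>\<open>a\<close> and \<open>b\<close> may be inhomogeneous, whereas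
    \<open>torsion_add_iota\<close> concerns homogeneous cycles. The degrees differ by one because
    \<open>d\<close> lowers degree.\<close>
  let ?a = "component gr r a" and ?b = "component gr (r + 1) b"
  have "component gr (r + 0) (\<iota> a) = \<iota> ?a" "component gr (r + 1 + - 1) (d b) = d ?b"
    by (rule graded_hom_component[OF iota_graded]) (rule graded_hom_component[OF d_graded])
  then have "component gr r x = ?a + \<iota> ?a + d ?b"
    by (simp add: xab component_add)
  then have "x = ?a + \<iota> ?a + d ?b"
    using x by (simp add: component_of_homogeneous)
  moreover have "d ?a = 0"
    using graded_hom_component[OF d_graded, of r a] a by (simp add: component_zero)
  then have "torsion (?a + \<iota> ?a)"
    by (rule torsion_add_iota[OF component_homogeneous])
  moreover have "torsion (d ?b)"
    by (simp add: torsion_range_d)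
  ultimately show False
    using x torsion_add by metis
qed

text \<open>The first half of the cone is shifted up by one, hence the extra values
  \<open>gr i + 1\<close>. The condition at \<open>U ^ 0\<close> is the case \<open>n = 0\<close> of
  the nonvanishing conditions in \<open>d_lower\<close> and \<open>d_upper\<close>.\<close>

lemma CFI_degree:
  assumes X: "X \<in> homology_deg I r" and nz: "hscal I (U ^ 0) X \<noteq> boundaries I"
  shows "\<exists>a\<in>range gr \<union> range (\<lambda>i. gr i + 1). \<exists>k. r = a - 2 * of_nat k"
proof -
  obtain x y where xy: "X = hclass I (x, y)" "x \<in> homogeneous gr (r - 1)" "y \<in> homogeneous gr r"
    using X by (auto simp: homology_deg_def CFI_simps)
  have "hscal I (U ^ 0) X = hclass I (x, y)"
    unfolding xy I.hscal_hclass power_0 I.scal_one ..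
  then have "(x, y) \<notin> boundaries I"
    using nz I.hclass_eq_boundaries_iff by simp
  then have "(x, y) \<noteq> 0"
    using I.zero_boundary by metis
  then consider "x \<noteq> 0" | "y \<noteq> 0"
    by (auto simp: zero_prod_def)
  then show ?thesis
  proof cases
    case 1
    then obtain i k where "r - 1 = gr i - 2 * of_nat k"
      using homogeneous_degree xy(2) by metis
    then have "r = (gr i + 1) - 2 * of_nat k"
      by linarith
    then show ?thesis
      by blast
  next
    case 2
    then show ?thesis
      using homogeneous_degree xy(3) by (metis UnI1 rangeI)
  qed
qed

text \<open>Classes in the image of \<open>Q\<close> are represented by pairs \<open>(0, a)\<close>.
  If a multiple of \<open>(x, y)\<close> by \<open>U ^ n\<close> vanished or lay in that image,
  \<open>U ^ n *s x\<close> would bound.\<close>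

lemma d_lower_ge:
  assumes x: "x \<in> homogeneous gr (r - 1)" "d x = 0" "\<not> torsion x"
    and y: "y \<in> homogeneous gr r" "x + \<iota> x = d y"
  shows "r + 1 \<le> d_lower C \<iota>"
proof -
  define P where "P r \<longleftrightarrow> (\<exists>X\<in>homology_deg I r. \<forall>n. hscal I (U ^ n) X \<noteq> boundaries I \<and>
    hscal I (U ^ n) X \<notin> im_Q C \<iota>)" for r
  have deg: "\<exists>a\<in>range gr \<union> range (\<lambda>i. gr i + 1). \<exists>k. r = a - 2 * of_nat k" if "P r" for r
    using that CFI_degree unfolding P_def by blast
  have "hscal I (U ^ n) (hclass I (x, y)) \<noteq> boundaries I" for n
    using x(3) unfolding I.hscal_eq_boundaries_iff CFI_simps boundaries_I torsion_def by blast
  moreover have "hscal I (U ^ n) (hclass I (x, y)) \<notin> im_Q C \<iota>" for n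
  proof
    assume "hscal I (U ^ n) (hclass I (x, y)) \<in> im_Q C \<iota>"
    then obtain a b where "hscal I (U ^ n) (hclass I (x, y)) = induced I Q (hclass I (a, b))"
      unfolding im_Q_def homology_def by auto
    then have "(U ^ n *s x, U ^ n *s y) - (0, a) \<in> boundaries I"
      unfolding induced_Q I.hscal_hclass I.hclass_eq_iff CFI_simps .
    then have "U ^ n *s x \<in> range d"
      by (auto simp: boundaries_I)
    then show False
      using x(3) by (auto simp: torsion_def)
  qed
  moreover have "hclass I (x, y) \<in> homology_deg I r"
    using x y by (auto simp: homology_deg_def cycles_I CFI_simps)
  ultimately have "P r"
    unfolding P_def by blast
  then have "r \<le> (GREATEST r. P r)"
    by (intro Greatest_degree(2)[of P r, OF _ _ deg]) simp_all
  then show ?thesis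
    by (simp add: d_lower_def P_def)
qed

lemma d_upper_attained:
  obtains r x y where "d_upper C \<iota> = r + 2" "x \<in> homogeneous gr (r - 1)" "y \<in> homogeneous gr r"
    "d x = 0" "x + \<iota> x = d y" "torsion x" "\<forall>n. (U ^ n *s x, U ^ n *s y) \<notin> boundaries I"
proof -
  define P where "P r \<longleftrightarrow> (\<exists>X\<in>homology_deg I r. (\<forall>n. hscal I (U ^ n) X \<noteq> boundaries I) \<and>
    (\<exists>m. hscal I (U ^ m) X \<in> im_Q C \<iota>))" for r
  have deg: "\<exists>a\<in>range gr \<union> range (\<lambda>i. gr i + 1). \<exists>k. r = a - 2 * of_nat k" if "P r" for r
    using that CFI_degree unfolding P_def by blast
  \<comment> \<open>The set of degrees is shown nonempty: after scaling a nontorsion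
    \<open>x0\<close> so that \<open>x + \<iota> x\<close> bounds, \<open>(x, b)\<close> is a cone
    cycle and \<open>Q\<close> maps its class to that of \<open>(0, x)\<close>.\<close>
  obtain r0 x0 where x0: "x0 \<in> homogeneous gr r0" "d x0 = 0" "\<not> torsion x0"
    using ex_tower by (auto simp: tower_def)
  obtain k b where "U ^ k *s (x0 + \<iota> x0) = d b"
    using torsion_add_iota[OF x0(1,2)] by (auto simp: torsion_def)
  moreover define x where "x = U ^ k *s x0"
  ultimately have xb: "x + \<iota> x = d b"
    by (simp add: iota_scale vector_add_ldistrib)
  have x: "x \<in> homogeneous gr (r0 - 2 * of_nat k)" "d x = 0" "\<not> torsion x"
    using x0 by (simp_all add: x_def homogeneous_U_power d_scale torsion_U_power_iff)
  have "hclass I (0, x) \<in> homology_deg I (r0 - 2 * of_nat k)"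
    using x by (auto simp: homology_deg_def cycles_I CFI_simps homogeneous_zero d_zero
        graded_hom_zero[OF iota_graded])
  moreover have "hscal I (U ^ n) (hclass I (0, x)) \<noteq> boundaries I" for n
    using nontorsion_Q[OF homogeneous_U_power[OF x(1)], of n] x(3)
    by (simp add: I.hscal_eq_boundaries_iff CFI_simps torsion_U_power_iff)
  moreover have "hscal I (U ^ 0) (hclass I (0, x)) \<in> im_Q C \<iota>"
  proof -
    have "hclass I (x, b) \<in> homology I"
      using xb x by (simp add: homology_def cycles_I)
    moreover have "hscal I (U ^ 0) (hclass I (0, x)) = induced I Q (hclass I (x, b))"
      unfolding induced_Q I.hscal_hclass power_0 I.scal_one ..
    ultimately show ?thesis
      unfolding im_Q_def by blast
  qed
  ultimately have "P (r0 - 2 * of_nat k)"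
    unfolding P_def by blast
  then have "P (GREATEST r. P r)"
    by (intro Greatest_degree(1)[of P, OF _ _ deg]) simp_all
  \<comment> \<open>Only the outer \<open>P\<close> is unfolded; the one under
    \<open>GREATEST\<close> stays folded.\<close>
  then obtain X m where X: "X \<in> homology_deg I (GREATEST r. P r)"
      "\<And>n. hscal I (U ^ n) X \<noteq> boundaries I" "hscal I (U ^ m) X \<in> im_Q C \<iota>"
    by (subst (asm) P_def) blast
  then obtain x y where xy: "(x, y) \<in> cycles I" "(x, y) \<in> homog I (GREATEST r. P r)"
      "X = hclass I (x, y)"
    unfolding homology_deg_def by auto
  have nz: "hscal I (U ^ n) (hclass I (x, y)) \<noteq> boundaries I" for n
    using X(2) xy(3) by simp
  have "hscal I (U ^ m) (hclass I (x, y)) \<in> im_Q C \<iota>"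
    using X(3) xy(3) by simp
  \<comment> \<open>Comparing first coordinates with a representative \<open>(0, a)\<close> shows
    that \<open>U ^ m *s x\<close> bounds.\<close>
  then obtain a b where "hscal I (U ^ m) (hclass I (x, y)) = induced I Q (hclass I (a, b))"
    unfolding im_Q_def homology_def by auto
  then have "(U ^ m *s x, U ^ m *s y) - (0, a) \<in> boundaries I"
    unfolding induced_Q I.hscal_hclass I.hclass_eq_iff CFI_simps .
  then have "U ^ m *s x \<in> range d"
    by (auto simp: boundaries_I)
  then have "torsion x"
    by (auto simp: torsion_def)
  moreover have "(U ^ n *s x, U ^ n *s y) \<notin> boundaries I" for n
    using nz[of n] by (simp add: I.hscal_eq_boundaries_iff CFI_simps)
  ultimately show thesis
    using that[of "GREATEST r. P r" x y] xy
    by (auto simp: d_upper_def P_def cycles_I CFI_simps)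
qed

end

section \<open>Self-local equivalences\<close>

locale self_local = iota_gr_complex gr d \<iota>
  for gr :: "'n::finite \<Rightarrow> rat" and d \<iota> :: "bit poly ^ 'n \<Rightarrow> bit poly ^ 'n" +
  fixes f :: "bit poly ^ 'n \<Rightarrow> bit poly ^ 'n"
  assumes self_local_equiv: "self_local_equiv C \<iota> f"
begin

lemma f_graded: "graded_hom gr 0 f"
  and f_d: "f (d x) = d (f x)"
  using self_local_equiv chain_map_free_complex[of gr d f] by (auto simp: self_local_equiv_def)

lemmas f_add = graded_hom_add[OF f_graded]
lemmas f_scale = graded_hom_scale[OF f_graded]
lemmas f_zero = graded_hom_zero[OF f_graded]

lemma f_homogeneous: "x \<in> homogeneous gr r \<Longrightarrow> f x \<in> homogeneous gr r"
  using graded_hom_homogeneous[OF f_graded] by fastforce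

lemma f_cycle: "d x = 0 \<Longrightarrow> d (f x) = 0"
  by (simp add: f_zero flip: f_d)

text \<open>Injectivity of \<open>f\<close> on the localization reflects torsion; any chain map
  preserves it.\<close>

lemma torsion_f_iff:
  assumes "d x = 0"
  shows "torsion (f x) \<longleftrightarrow> torsion x"
proof
  have loc_map: "loc_map C f (frac C (hclass C z) 0) = frac C (hclass C (f z)) 0" if "d z = 0" for z
    using that
    by (intro C.loc_map_frac)
      (auto simp: cycles_C boundaries_C f_add f_scale f_d f_cycle free_complex_simps)
  assume "torsion (f x)"
  then have eq: "loc_map C f (frac C (hclass C x) 0) = loc_map C f (frac C (hclass C 0) 0)"
    using assms by (simp add: loc_map f_cycle frac_eq_zero_iff d_zero f_zero)
  have inj: "inj_on (loc_map C f) (loc C)"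
    using self_local_equiv by (simp add: self_local_equiv_def bij_betw_def)
  have "frac C (hclass C x) 0 = frac C (hclass C 0) 0"
    by (rule inj_onD[OF inj eq]) (auto intro!: C.frac_in_loc simp: cycles_C assms d_zero)
  then show "torsion x"
    using assms by (simp add: frac_eq_zero_iff)
qed (rule torsion_chain_map[OF f_graded f_d])

section \<open>The image complex and its torsion exponent\<close>

abbreviation F where "F \<equiv> image_complex C f"

lemma boundaries_F: "boundaries F = d ` range f"
  by (simp add: boundaries_def image_complex_def free_complex_simps)

lemma F_simps:
  "scal F p x = p *s x" "homog F r = homogeneous gr r \<inter> range f"
  "x \<in> cycles F \<longleftrightarrow> x \<in> range f \<and> d x = 0"
  by (simp_all add: cycles_def image_complex_def free_complex_simps homog_free_complex)

sublocale F: homology_complex F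
proof
  show "0 \<in> boundaries F"
    unfolding boundaries_F by (metis d_zero f_zero rangeI image_eqI)
  show "x + y \<in> boundaries F" if "x \<in> boundaries F" "y \<in> boundaries F" for x y
    using that unfolding boundaries_F by (auto simp flip: f_add d_add)
  show "scal F p x \<in> boundaries F" if "x \<in> boundaries F" for p x
    using that unfolding boundaries_F
    by (auto simp: F_simps simp flip: f_scale d_scale)
qed (simp_all add: bit_poly_vec_uminus F_simps vector_add_ldistrib vector_smult_assoc)

lemma hscal_F_eq_boundaries_iff:
  "hscal F (U ^ n) (hclass F x) = boundaries F \<longleftrightarrow> U ^ n *s x \<in> d ` range f"
  using F.hscal_eq_boundaries_iff[of "U ^ n" x] by (simp only: boundaries_F F_simps)

text \<open>
  \<open>U\<close> is invertible in degrees below every grading of the basis, so a torsion class of the image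
  dies as soon as multiplication by \<open>U\<close> has moved it there.
\<close>

lemma torsion_exponent_exists:
  "\<exists>N. \<forall>r. \<forall>X\<in>HF_conn C f r. hscal F (U ^ N) X = boundaries F"
proof -
  obtain lo hi where lo: "\<And>i. lo \<le> gr i" and hi: "\<And>i. gr i \<le> hi"
    using Min_le[of "range gr"] Max_ge[of "range gr"] by (metis finite finite_imageI rangeI)
  \<comment> \<open>A primitive of \<open>U ^ N *s z\<close> has degree
    \<open>r - 2 * of_nat N\<close>, one above \<open>U ^ N *s z\<close>. As
    \<open>r - 1 \<le> hi\<close>, the extra \<open>1\<close> places it at or below
    \<open>lo\<close>.\<close>
  obtain N :: nat where N: "hi + 1 - lo \<le> 2 * of_nat N"
    using real_arch_simple[of "(hi + 1 - lo) / 2"] by (auto simp: field_simps)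
  have "hscal F (U ^ N) X = boundaries F" if X: "X \<in> HF_conn C f r" for X r
  proof -
    obtain z n where z: "X = hclass F z" "z \<in> homogeneous gr (r - 1)"
        and "hscal F (U ^ n) X = boundaries F"
      using X by (auto simp: HF_conn_def homology_deg_def F_simps)
    then obtain c0 where c0: "U ^ n *s z = d (f c0)"
      unfolding z hscal_F_eq_boundaries_iff by auto
    have df: "graded_hom gr (- 1) (d \<circ> f)"
      using graded_hom_comp[OF f_graded d_graded] by simp
    \<comment> \<open>The homogeneous choice is made for \<open>c\<close> in the whole complex
      through \<open>d \<circ> f\<close>, so the primitive \<open>f c\<close> stays in the
      image.\<close>
    obtain c where c: "c \<in> homogeneous gr (r - 2 * of_nat n)" "U ^ n *s z = d (f c)"
    proof -
      have "(d \<circ> f) c0 \<in> homogeneous gr (r - 2 * of_nat n + - 1)"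
        using homogeneous_U_power[OF z(2), of n] c0 by (simp add: algebra_simps)
      then show thesis
        using graded_hom_preimage[OF df] that c0 by (metis comp_apply)
    qed
    have "U ^ N *s z \<in> d ` range f"
    proof (cases "z = 0 \<or> n \<le> N")
      case True
      then show ?thesis
      proof
        assume "z = 0"
        then show ?thesis
          using F.zero_boundary by (simp add: boundaries_F)
      next
        assume "n \<le> N"
        then have "U ^ N *s z = U ^ (N - n) *s (U ^ n *s z)"
          by (simp add: vector_smult_assoc flip: power_add)
        also have "\<dots> = d (f (U ^ (N - n) *s c))"
          by (simp add: c f_scale d_scale)
        finally show ?thesis
          by simp
      qed
    next
      case False
      then have n: "N \<le> n" "(of_nat (n - N) :: rat) = of_nat n - of_nat N"
        by (auto simp: of_nat_diff)
      have "r - 1 \<le> hi"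
      proof -
        obtain i k where "r - 1 = gr i - 2 * of_nat k"
          using False homogeneous_degree z(2) by metis
        then show ?thesis
          using hi[of i] of_nat_0_le_iff[of k, where 'a = rat] by linarith
      qed
      then have "r - 2 * of_nat N \<le> gr i" for i
        using N lo[of i] by linarith
      moreover have "c \<in> homogeneous gr (r - 2 * of_nat N - 2 * of_nat (n - N))"
        using c(1) n(2) by simp
      ultimately obtain c' where c': "c = U ^ (n - N) *s c'"
        using homogeneous_divisible by metis
      have "U ^ n *s z = U ^ (n - N) *s (U ^ N *s z)"
        using n by (simp add: vector_smult_assoc flip: power_add)
      \<comment> \<open>Freeness allows the common factor \<open>U ^ (n - N)\<close> to be
        cancelled.\<close>
      then have "U ^ (n - N) *s (U ^ N *s z + d (f c')) = 0"
        using c(2) by (simp add: c' f_scale d_scale vector_add_ldistrib bit_poly_vec_add_self)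
      then have "U ^ N *s z = d (f c')"
        by (simp only: U_power_smult_eq_0_iff bit_poly_vec_add_eq_0_iff)
      then show ?thesis
        by simp
    qed
    then show ?thesis
      unfolding z hscal_F_eq_boundaries_iff .
  qed
  then show ?thesis
    by blast
qed

text \<open>If \<open>U ^ n *s z = d u\<close>, then \<open>f u\<close> is a primitive of
  \<open>U ^ n *s f z\<close> inside the image. Thus \<open>f z\<close> is torsion in the homology
  of the image and is killed by the exponent \<open>\<omega>\<close>, again with a primitive of the
  form \<open>f c\<close>.\<close>

lemma omega_kills_torsion:
  assumes z: "z \<in> homogeneous gr r" "d z = 0" "torsion z"
  obtains c where "U ^ \<omega> C f *s f z = d (f c)"
proof -
  have kill: "\<forall>r. \<forall>X\<in>HF_conn C f r. hscal F (U ^ \<omega> C f) X = boundaries F"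
    unfolding \<omega>_def by (rule LeastI_ex[OF torsion_exponent_exists])
  obtain n u where "U ^ n *s z = d u"
    using z by (auto simp: torsion_def)
  then have "U ^ n *s f z = d (f u)"
    using f_d[of u] f_scale[of _ z] by metis
  then have "hscal F (U ^ n) (hclass F (f z)) = boundaries F"
    unfolding hscal_F_eq_boundaries_iff by simp
  \<comment> \<open>The degree is written \<open>r + 1 - 1\<close> to match the shift in
    \<open>HF_conn\<close>.\<close>
  moreover have "hclass F (f z) \<in> homology_deg F (r + 1 - 1)"
    using z by (auto simp: homology_deg_def F_simps f_homogeneous f_cycle)
  ultimately have "hclass F (f z) \<in> HF_conn C f (r + 1)"
    unfolding HF_conn_def by blast
  then have "U ^ \<omega> C f *s f z \<in> d ` range f"
    using kill hscal_F_eq_boundaries_iff by blast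
  then show thesis
    using that by auto
qed

section \<open>The two inequalities\<close>

lemma f_iota_homotopy:
  obtains h where "graded_hom gr 1 h" "\<And>x. f (\<iota> x) = \<iota> (f x) + d (h x) + h (d x)"
proof -
  have "homotopic C (f \<circ> \<iota>) (\<iota> \<circ> f)"
    using self_local_equiv by (simp add: self_local_equiv_def)
  then obtain h where h: "graded_hom gr 1 h" "\<And>x. f (\<iota> x) + \<iota> (f x) = d (h x) + h (d x)"
    using homotopic_free_complex by (metis comp_apply)
  have "f (\<iota> x) = \<iota> (f x) + d (h x) + h (d x)" for x
    unfolding add.assoc h(2)[symmetric] by (simp add: bit_poly_vec_simps)
  with h(1) show thesis
    by (rule that)
qed

lemma d_lower_bound: "d_inv C - d_lower C \<iota> \<le> 2 * of_nat (\<omega> C f)"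
proof -
  define s where "s = (GREATEST r. tower r)"
  define n where "n = \<omega> C f"
  obtain x where x: "x \<in> homogeneous gr s" "d x = 0" "\<not> torsion x"
    using tower_Greatest by (auto simp: tower_def s_def)
  obtain h where h: "graded_hom gr 1 h" "\<And>x. f (\<iota> x) = \<iota> (f x) + d (h x) + h (d x)"
    by (rule f_iota_homotopy) blast
  have "d (x + \<iota> x) = 0"
    using x iota_d[of x] graded_hom_zero[OF iota_graded] by (simp add: d_add)
  then obtain c where c: "U ^ n *s f (x + \<iota> x) = d (f c)"
    using omega_kills_torsion[of "x + \<iota> x" s] x iota_homogeneous homogeneous_add torsion_add_iota
    unfolding n_def by metis
  define x' where "x' = U ^ n *s f x"
  have x': "x' \<in> homogeneous gr (s - 2 * of_nat n)" "d x' = 0" "\<not> torsion x'"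
    using x by (simp_all add: x'_def homogeneous_U_power f_homogeneous d_scale f_cycle
        torsion_U_power_iff torsion_f_iff)
  have "f (x + \<iota> x) = f x + \<iota> (f x) + d (h x)"
    using x graded_hom_zero[OF h(1)] by (simp add: f_add h(2) add.assoc)
  then have "f x + \<iota> (f x) = f (x + \<iota> x) + d (h x)"
    by (simp add: bit_poly_vec_simps)
  then have "x' + \<iota> x' = U ^ n *s (f (x + \<iota> x) + d (h x))"
    by (simp add: x'_def iota_scale flip: vector_add_ldistrib)
  also have "\<dots> = d (f c + U ^ n *s h x)"
    by (simp add: vector_add_ldistrib c d_add d_scale)
  finally have "x' + \<iota> x' \<in> range d"
    by simp
  then obtain y where "y \<in> homogeneous gr (s - 2 * of_nat n + 1)" "x' + \<iota> x' = d y"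
    using range_d_homogeneous homogeneous_add x'(1) iota_homogeneous by metis
  \<comment> \<open>One \<open>1\<close> is the cone shift of \<open>x'\<close>, the other the
    normalization of \<open>d_lower\<close>; together they match the \<open>2\<close> in
    \<open>d_inv\<close>.\<close>
  then have "s - 2 * of_nat n + 1 + 1 \<le> d_lower C \<iota>"
    using d_lower_ge[of x' "s - 2 * of_nat n + 1" y] x' by simp
  then show ?thesis
    by (simp add: d_inv_eq s_def n_def)
qed

lemma d_upper_bound: "d_upper C \<iota> - d_inv C \<le> 2 * of_nat (\<omega> C f)"
proof -
  define n where "n = \<omega> C f"
  obtain r x y where r: "d_upper C \<iota> = r + 2"
    and x: "x \<in> homogeneous gr (r - 1)" and y: "y \<in> homogeneous gr r"
    and dx: "d x = 0" and dy: "x + \<iota> x = d y" and tx: "torsion x"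
    and nz: "\<forall>n. (U ^ n *s x, U ^ n *s y) \<notin> boundaries I"
    by (rule d_upper_attained)
  note x = x dx tx and y = y dy
  obtain h where h: "graded_hom gr 1 h" "\<And>x. f (\<iota> x) = \<iota> (f x) + d (h x) + h (d x)"
    by (rule f_iota_homotopy) blast
  \<comment> \<open>The exponent \<open>m\<close> is uncontrolled and serves to test nontorsion; the
    degree loss comes from \<open>n\<close> alone.\<close>
  obtain m where "U ^ m *s x \<in> range d"
    using x by (auto simp: torsion_def)
  then obtain p where p: "p \<in> homogeneous gr (r - 2 * of_nat m)" "U ^ m *s x = d p"
    using range_d_homogeneous[of "U ^ m *s x" "r - 1 - 2 * of_nat m"] homogeneous_U_power[OF x(1)]
    by (auto simp: algebra_simps)
  obtain c0 where c0: "U ^ n *s f x = d (f c0)"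
    using omega_kills_torsion[OF x] unfolding n_def by metis
  have df: "graded_hom gr (- 1) (d \<circ> f)"
    using graded_hom_comp[OF f_graded d_graded] by simp
  have "(d \<circ> f) c0 \<in> homogeneous gr (r - 2 * of_nat n + - 1)"
    using homogeneous_U_power[OF f_homogeneous[OF x(1)], of n] c0 by (simp add: algebra_simps)
  then obtain c where c: "c \<in> homogeneous gr (r - 2 * of_nat n)" "U ^ n *s f x = d (f c)"
    using graded_hom_preimage[OF df] c0 by (metis comp_apply)
  \<comment> \<open>The map of cones sends \<open>(x, y)\<close> to \<open>(f x, f y + h x)\<close>.
    Scaling by \<open>U ^ n\<close> and subtracting the boundary of \<open>(f c, 0)\<close> leaves
    \<open>(0, y')\<close>.\<close>
  define y' where "y' = U ^ n *s (f y + h x) + (f c + \<iota> (f c))"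
  have y'_homogeneous: "y' \<in> homogeneous gr (r - 2 * of_nat n)"
    unfolding y'_def using graded_hom_homogeneous[OF h(1) x(1)] y(1) c(1)
    by (intro homogeneous_add homogeneous_U_power f_homogeneous iota_homogeneous) simp_all
  have dfy: "d (f y) = f x + (\<iota> (f x) + d (h x))"
    using h(2)[of x] x(2) graded_hom_zero[OF h(1)]
    by (simp add: f_add add.assoc flip: f_d y(2))
  have d_y': "d y' = 0"
    unfolding y'_def
    by (simp add: d_add d_scale dfy vector_add_ldistrib bit_poly_vec_simps
        flip: c(2) iota_d iota_scale)
  \<comment> \<open>Subtracting the boundary of \<open>(p, 0)\<close> from \<open>U ^ m\<close>
    times \<open>(x, y)\<close> leaves \<open>(0, a)\<close>.\<close>
  define a where "a = U ^ m *s y + (p + \<iota> p)"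
  \<comment> \<open>Both summands are primitives of \<open>U ^ (m + n) *s f x\<close>, so
    \<open>v\<close> is a cycle.\<close>
  define v where "v = U ^ n *s f p + U ^ m *s f c"
  have d_a: "d a = 0"
    unfolding a_def
    by (simp add: d_add d_scale vector_add_ldistrib bit_poly_vec_simps
        flip: p(2) iota_d iota_scale y(2))
  have d_fp: "d (f p) = U ^ m *s f x"
    by (simp flip: f_d f_scale p(2))
  have d_v: "d v = 0"
    unfolding v_def
    by (simp add: d_add d_scale d_fp vector_smult_assoc bit_poly_vec_simps flip: c(2))
  have "v \<in> homogeneous gr (r - 2 * of_nat m - 2 * of_nat n)"
    unfolding v_def
    using homogeneous_U_power[OF f_homogeneous[OF p(1)], of n]
      homogeneous_U_power[OF f_homogeneous[OF c(1)], of m]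
    by (intro homogeneous_add) (simp_all add: algebra_simps)
  then have "torsion (v + \<iota> v)"
    using d_v by (rule torsion_add_iota)
  \<comment> \<open>Up to torsion, \<open>U ^ m *s y'\<close> agrees with
    \<open>U ^ n *s f a\<close>. The \<open>h x\<close> term arises from \<open>h (d p)\<close> in
    the homotopy formula for \<open>f (\<iota> p)\<close>.\<close>
  have Uy': "U ^ m *s y' = U ^ n *s f a + ((v + \<iota> v) + d (U ^ n *s h p))"
    unfolding y'_def a_def v_def
    by (simp add: f_add f_scale iota_add iota_scale h(2) vector_add_ldistrib vector_smult_assoc
        d_scale graded_hom_scale[OF h(1)] bit_poly_vec_simps flip: p(2))
  have "\<not> torsion y'"
  proof
    assume "torsion y'"
    then have "torsion (U ^ n *s f a + ((v + \<iota> v) + d (U ^ n *s h p)))"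
      by (simp add: torsion_U_power_iff flip: Uy')
    moreover have "torsion ((v + \<iota> v) + d (U ^ n *s h p))"
      using \<open>torsion (v + \<iota> v)\<close> by (rule torsion_add) (simp add: torsion_range_d)
    ultimately have "torsion (U ^ n *s f a)"
      by (rule torsion_add_cancel)
    then have "torsion a"
      by (simp add: torsion_U_power_iff torsion_f_iff[OF d_a])
    then obtain j e where e: "U ^ j *s a = d e"
      by (auto simp: torsion_def)
    \<comment> \<open>A torsion \<open>a\<close> would make \<open>U ^ (j + m)\<close> times
      \<open>(x, y)\<close> the cone boundary of \<open>(U ^ j *s p, e)\<close>.\<close>
    have "U ^ (j + m) *s x = d (U ^ j *s p)"
      by (simp add: power_add d_scale vector_smult_assoc flip: p(2))
    moreover have "U ^ (j + m) *s y = U ^ j *s p + \<iota> (U ^ j *s p) + d e"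
      unfolding e[symmetric] a_def
      by (simp add: power_add iota_scale vector_smult_assoc vector_add_ldistrib bit_poly_vec_simps)
    ultimately show False
      using nz unfolding boundaries_I by blast
  qed
  then have "tower (r - 2 * of_nat n)"
    using y'_homogeneous d_y' by (auto simp: tower_def)
  then show ?thesis
    using tower_le_Greatest by (fastforce simp: d_inv_eq r n_def)
qed

end

theorem proposition1p7:
  fixes gr :: "'n::finite \<Rightarrow> rat"
    and d \<iota> f :: "bit poly ^ 'n \<Rightarrow> bit poly ^ 'n"
  assumes "iota_complex gr d \<iota>"
    and "maximal_self_local_equiv (free_complex gr d) \<iota> f"
  shows "(d_inv (free_complex gr d) - d_lower (free_complex gr d) \<iota>) / 2
           \<le> of_nat (\<omega> (free_complex gr d) f) \<and>
         (d_upper (free_complex gr d) \<iota> - d_inv (free_complex gr d)) / 2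
           \<le> of_nat (\<omega> (free_complex gr d) f)"
proof -
  interpret self_local gr d \<iota> f
    using assms unfolding iota_complex_def maximal_self_local_equiv_def
    by unfold_locales blast+
  show ?thesis
    using d_lower_bound d_upper_bound by simp
qed

end
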